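(* Let $\Sigma_r=\{0,1,-,+,\cdot\}$ (constants $0,1$, unary minus $-$, binary $+$ and $\cdot$). The term rewriting system $D_2$ obtained by orienting the following twelve equations from left to right is ground-complete: [R1] $x+0=x$; [R2$'$] $0+1=1$; [R3$'$] $x+(y+1)=(x+y)+1$; [R4] $x\cdot 0=0$; [R5] $x\cdot 1=x$; [R6$'$] $x\cdot(y+1)=(x\cdot y)+x$; [R7] $-0=0$; [R8] $(-1)+1=0$; [R9] $(-(x+1))+1=-x$; [R10] $-(-x)=x$; [R11] $x+(-y)=-((-x)+y)$; [R12] $x\cdot(-y)=-(x\cdot y)$.
   Context: Each equation is read as a rewrite rule from left to right, where $x,y$ are variables. A term rewriting system is ground-complete if it is strongly terminating (no infinite rewrite sequences) and ground-confluent (confluent on closed terms), so that every closed term has a unique normal form. *)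

theory Defs
  imports Main
begin

datatype trm =
    Var nat
  | Zero  ("\<zero>")
  | One  ("\<one>")
  | Neg trm  ("\<ominus> _" [81] 80)
  | Plus trm trm  (infixl "\<oplus>" 65)
  | Times trm trm  (infixl "\<odot>" 70)

primrec vars :: "trm \<Rightarrow> nat set" where
  "vars (Var v) = {v}"
| "vars \<zero> = {}"
| "vars \<one> = {}"
| "vars (\<ominus> s) = vars s"
| "vars (s \<oplus> t) = vars s \<union> vars t"
| "vars (s \<odot> t) = vars s \<union> vars t"

definition closed_trm :: "trm \<Rightarrow> bool" where
  "closed_trm t \<longleftrightarrow> vars t = {}"

primrec subst :: "(nat \<Rightarrow> trm) \<Rightarrow> trm \<Rightarrow> trm" where
  "subst \<sigma> (Var v) = \<sigma> v"
| "subst \<sigma> \<zero> = \<zero>"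
| "subst \<sigma> \<one> = \<one>"
| "subst \<sigma> (\<ominus> s) = \<ominus> (subst \<sigma> s)"
| "subst \<sigma> (s \<oplus> t) = subst \<sigma> s \<oplus> subst \<sigma> t"
| "subst \<sigma> (s \<odot> t) = subst \<sigma> s \<odot> subst \<sigma> t"

type_synonym trs = "(trm \<times> trm) set"

inductive rewrite :: "trs \<Rightarrow> trm \<Rightarrow> trm \<Rightarrow> bool" for R :: trs where
  root: "(l, r) \<in> R \<Longrightarrow> rewrite R (subst \<sigma> l) (subst \<sigma> r)"
| Neg: "rewrite R s s' \<Longrightarrow> rewrite R (\<ominus> s) (\<ominus> s')"
| Plus_left: "rewrite R s s' \<Longrightarrow> rewrite R (s \<oplus> t) (s' \<oplus> t)"
| Plus_right: "rewrite R t t' \<Longrightarrow> rewrite R (s \<oplus> t) (s \<oplus> t')"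
| Times_left: "rewrite R s s' \<Longrightarrow> rewrite R (s \<odot> t) (s' \<odot> t)"
| Times_right: "rewrite R t t' \<Longrightarrow> rewrite R (s \<odot> t) (s \<odot> t')"

text \<open>Termination is required on all terms, open ones included; confluence only from
  closed terms.\<close>

definition strongly_terminating :: "trs \<Rightarrow> bool" where
  "strongly_terminating R \<longleftrightarrow>
     (\<nexists>f :: nat \<Rightarrow> trm. \<forall>i. rewrite R (f i) (f (Suc i)))"

definition ground_confluent :: "trs \<Rightarrow> bool" where
  "ground_confluent R \<longleftrightarrow>
     (\<forall>s t u. closed_trm s \<and> closed_trm t \<and> closed_trm u \<and> (rewrite R)\<^sup>*\<^sup>* s t \<and> (rewrite R)\<^sup>*\<^sup>* s u \<longrightarrow>
        (\<exists>v. closed_trm v \<and> (rewrite R)\<^sup>*\<^sup>* t v \<and> (rewrite R)\<^sup>*\<^sup>* u v))"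

definition ground_complete :: "trs \<Rightarrow> bool" where
  "ground_complete R \<longleftrightarrow> strongly_terminating R \<and> ground_confluent R"

definition D2 :: trs where
  "D2 = (let x = Var 0; y = Var 1 in
    {(x \<oplus> \<zero>, x),
     (\<zero> \<oplus> \<one>, \<one>),
     (x \<oplus> (y \<oplus> \<one>), (x \<oplus> y) \<oplus> \<one>),
     (x \<odot> \<zero>, \<zero>),
     (x \<odot> \<one>, x),
     (x \<odot> (y \<oplus> \<one>), (x \<odot> y) \<oplus> x),
     (\<ominus> \<zero>, \<zero>),
     ((\<ominus> \<one>) \<oplus> \<one>, \<zero>),
     ((\<ominus> (x \<oplus> \<one>)) \<oplus> \<one>, \<ominus> x),
     (\<ominus> (\<ominus> x), x),
     (x \<oplus> (\<ominus> y), \<ominus> ((\<ominus> x) \<oplus> y)),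
     (x \<odot> (\<ominus> y), \<ominus> (x \<odot> y))})"

end

theory Submission
  imports Defs
begin

text \<open>Termination follows from an interpretation in the positive integers that is strictly
  monotone in every argument and decreases under every rule. Evaluation in the integers is
  invariant under rewriting, and the irreducible closed terms are the numerals
  \<open>0\<close>, \<open>1\<close>, \<open>1 + 1\<close>, \<open>(1 + 1) + 1\<close>, \dots and the negations of the nonzero ones, which have pairwise
  distinct values. So a closed term reduces to the unique numeral with its value.\<close>

text \<open>In the rule for \<open>x \<oplus> (\<ominus> y)\<close> the left negation contributes
  the coefficient of the right summand and the two on the right-hand side contribute 2, hence the
  factor 3. Without the extra \<open>weight t\<close> in products, both sides of the rule for
  \<open>x \<odot> (y \<oplus> \<one>)\<close> would weigh the same.\<close>

primrec weight :: "trm \<Rightarrow> nat" where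
  "weight (Var v) = 1"
| "weight \<zero> = 1"
| "weight \<one> = 1"
| "weight (\<ominus> s) = weight s + 1"
| "weight (s \<oplus> t) = weight s + 3 * weight t"
| "weight (s \<odot> t) = weight s * weight t + weight t"

primrec eval_int :: "trm \<Rightarrow> int" where
  "eval_int (Var v) = 0"
| "eval_int \<zero> = 0"
| "eval_int \<one> = 1"
| "eval_int (\<ominus> s) = - eval_int s"
| "eval_int (s \<oplus> t) = eval_int s + eval_int t"
| "eval_int (s \<odot> t) = eval_int s * eval_int t"

inductive pos_numeral :: "trm \<Rightarrow> bool" where
  One: "pos_numeral \<one>"
| Succ: "pos_numeral s \<Longrightarrow> pos_numeral (s \<oplus> \<one>)"

text \<open>Only positive numerals are negated: \<open>\<ominus> \<zero>\<close> would be a second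
  name for the value 0.\<close>

definition numeral_trm :: "trm \<Rightarrow> bool" where
  "numeral_trm t \<longleftrightarrow> t = \<zero> \<or> pos_numeral t \<or> (\<exists>s. pos_numeral s \<and> t = \<ominus> s)"

lemma weight_pos: "weight t > 0"
  by (induction t) auto

lemma rewrite_D2_weight: "rewrite D2 s t \<Longrightarrow> weight t < weight s"
proof (induction rule: rewrite.induct)
  case (root l r \<sigma>)
  then show ?case
    using weight_pos[of "\<sigma> 0"] weight_pos[of "\<sigma> 1"]
    by (auto simp: D2_def Let_def algebra_simps)
next
  \<comment> \<open>The left factor enters only through \<open>weight s * weight t\<close>, so
    strictness rests on \<open>weight t\<close> being positive.\<close>
  case (Times_left s s' t)
  then show ?case using weight_pos[of t] by simp
next
  case (Times_right t t' s)
  then show ?case by (simp add: add_le_less_mono)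
qed auto

lemma rewrite_D2_eval_int: "rewrite D2 s t \<Longrightarrow> eval_int t = eval_int s"
proof (induction rule: rewrite.induct)
  case (root l r \<sigma>)
  then show ?case by (auto simp: D2_def Let_def algebra_simps)
qed auto

lemma rewrite_D2_closed: "rewrite D2 s t \<Longrightarrow> closed_trm s \<Longrightarrow> closed_trm t"
  unfolding closed_trm_def
proof (induction rule: rewrite.induct)
  case (root l r \<sigma>)
  then show ?case by (auto simp: D2_def Let_def)
qed auto

lemma rewrites_D2_eval_int: "(rewrite D2)\<^sup>*\<^sup>* s t \<Longrightarrow> eval_int t = eval_int s"
  by (induction rule: rtranclp_induct) (auto dest: rewrite_D2_eval_int)

lemma rewrites_D2_closed: "(rewrite D2)\<^sup>*\<^sup>* s t \<Longrightarrow> closed_trm s \<Longrightarrow> closed_trm t"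
  by (induction rule: rtranclp_induct) (auto dest: rewrite_D2_closed)

text \<open>Instances with the substitution already carried out, so that they unify with concrete
  terms when used as introduction rules.\<close>

lemma D2_root_steps:
  "rewrite D2 (x \<oplus> \<zero>) x"
  "rewrite D2 (\<zero> \<oplus> \<one>) \<one>"
  "rewrite D2 (x \<oplus> (y \<oplus> \<one>)) ((x \<oplus> y) \<oplus> \<one>)"
  "rewrite D2 (x \<odot> \<zero>) \<zero>"
  "rewrite D2 (x \<odot> \<one>) x"
  "rewrite D2 (x \<odot> (y \<oplus> \<one>)) ((x \<odot> y) \<oplus> x)"
  "rewrite D2 (\<ominus> \<zero>) \<zero>"
  "rewrite D2 ((\<ominus> \<one>) \<oplus> \<one>) \<zero>"
  "rewrite D2 ((\<ominus> (x \<oplus> \<one>)) \<oplus> \<one>) (\<ominus> x)"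
  "rewrite D2 (\<ominus> (\<ominus> x)) x"
  "rewrite D2 (x \<oplus> (\<ominus> y)) (\<ominus> ((\<ominus> x) \<oplus> y))"
  "rewrite D2 (x \<odot> (\<ominus> y)) (\<ominus> (x \<odot> y))"
proof -
  \<comment> \<open>The rules contain only the variables 0 and 1, so this one substitution serves
    for all of them.\<close>
  have step: "rewrite D2 s t"
    if "(l, r) \<in> D2" "s = subst (\<lambda>n. if n = 0 then x else y) l"
      "t = subst (\<lambda>n. if n = 0 then x else y) r" for l r s t
    using rewrite.root[OF that(1)] that(2,3) by simp
  let ?x = "Var 0" and ?y = "Var 1"
  show "rewrite D2 (x \<oplus> \<zero>) x"
    by (rule step[of "?x \<oplus> \<zero>" ?x]) (simp_all add: D2_def Let_def)
  show "rewrite D2 (\<zero> \<oplus> \<one>) \<one>"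
    by (rule step[of "\<zero> \<oplus> \<one>" \<one>]) (simp_all add: D2_def Let_def)
  show "rewrite D2 (x \<oplus> (y \<oplus> \<one>)) ((x \<oplus> y) \<oplus> \<one>)"
    by (rule step[of "?x \<oplus> (?y \<oplus> \<one>)" "(?x \<oplus> ?y) \<oplus> \<one>"]) (simp_all add: D2_def Let_def)
  show "rewrite D2 (x \<odot> \<zero>) \<zero>"
    by (rule step[of "?x \<odot> \<zero>" \<zero>]) (simp_all add: D2_def Let_def)
  show "rewrite D2 (x \<odot> \<one>) x"
    by (rule step[of "?x \<odot> \<one>" ?x]) (simp_all add: D2_def Let_def)
  show "rewrite D2 (x \<odot> (y \<oplus> \<one>)) ((x \<odot> y) \<oplus> x)"
    by (rule step[of "?x \<odot> (?y \<oplus> \<one>)" "(?x \<odot> ?y) \<oplus> ?x"]) (simp_all add: D2_def Let_def)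
  show "rewrite D2 (\<ominus> \<zero>) \<zero>"
    by (rule step[of "\<ominus> \<zero>" \<zero>]) (simp_all add: D2_def Let_def)
  show "rewrite D2 ((\<ominus> \<one>) \<oplus> \<one>) \<zero>"
    by (rule step[of "(\<ominus> \<one>) \<oplus> \<one>" \<zero>]) (simp_all add: D2_def Let_def)
  show "rewrite D2 ((\<ominus> (x \<oplus> \<one>)) \<oplus> \<one>) (\<ominus> x)"
    by (rule step[of "(\<ominus> (?x \<oplus> \<one>)) \<oplus> \<one>" "\<ominus> ?x"]) (simp_all add: D2_def Let_def)
  show "rewrite D2 (\<ominus> (\<ominus> x)) x"
    by (rule step[of "\<ominus> (\<ominus> ?x)" ?x]) (simp_all add: D2_def Let_def)
  show "rewrite D2 (x \<oplus> (\<ominus> y)) (\<ominus> ((\<ominus> x) \<oplus> y))"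
    by (rule step[of "?x \<oplus> (\<ominus> ?y)" "\<ominus> ((\<ominus> ?x) \<oplus> ?y)"]) (simp_all add: D2_def Let_def)
  show "rewrite D2 (x \<odot> (\<ominus> y)) (\<ominus> (x \<odot> y))"
    by (rule step[of "?x \<odot> (\<ominus> ?y)" "\<ominus> (?x \<odot> ?y)"]) (simp_all add: D2_def Let_def)
qed

lemma closed_numeral_or_reducible:
  "closed_trm t \<Longrightarrow> numeral_trm t \<or> (\<exists>t'. rewrite D2 t t')"
proof (induction t)
  case (Var v)
  then show ?case by (simp add: closed_trm_def)
next
  case Zero
  show ?case by (simp add: numeral_trm_def)
next
  case One
  show ?case by (simp add: numeral_trm_def pos_numeral.One)
next
  case (Neg s)
  then consider "\<exists>s'. rewrite D2 s s'" | "numeral_trm s"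
    by (auto simp: closed_trm_def)
  then show ?case
  proof cases
    case 1
    then show ?thesis by (blast intro: rewrite.Neg)
  next
    case 2
    then show ?thesis unfolding numeral_trm_def by (blast intro: D2_root_steps)
  qed
next
  case (Plus s t)
  then consider "\<exists>s'. rewrite D2 s s'" | "\<exists>t'. rewrite D2 t t'" | "numeral_trm s" "numeral_trm t"
    by (auto simp: closed_trm_def)
  then show ?case
  proof cases
    case 1
    then show ?thesis by (blast intro: rewrite.Plus_left)
  next
    case 2
    then show ?thesis by (blast intro: rewrite.Plus_right)
  next
    case 3
    \<comment> \<open>The rules for sums inspect the right summand first. Every shape except
      \<open>\<one>\<close> matches a rule with an arbitrary left summand.\<close>
    from 3(2) consider "t = \<zero>" | "t = \<one>" | u where "t = u \<oplus> \<one>" | u where "t = \<ominus> u"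
      unfolding numeral_trm_def by (metis pos_numeral.cases)
    then show ?thesis
    proof cases
      \<comment> \<open>For \<open>s \<oplus> \<one>\<close> the sign of \<open>s\<close> decides:
        if \<open>s\<close> is positive the sum is itself a numeral, otherwise a rule cancels the
        zero or absorbs the one into the negation.\<close>
      case 2
      from 3(1) consider "s = \<zero>" | "pos_numeral s" | "s = \<ominus> \<one>" | u where "s = \<ominus> (u \<oplus> \<one>)"
        unfolding numeral_trm_def by (metis pos_numeral.cases)
      then show ?thesis
        unfolding 2
        by cases (blast intro: D2_root_steps, simp add: numeral_trm_def pos_numeral.Succ,
            (blast intro: D2_root_steps)+)
    qed (blast intro: D2_root_steps)+
  qed
next
  case (Times s t)
  \<comment> \<open>No case on \<open>s\<close> is needed: each shape of a numeral as right factor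
    triggers a rule with an arbitrary left factor.\<close>
  then consider "\<exists>t'. rewrite D2 t t'" | "numeral_trm t"
    by (auto simp: closed_trm_def)
  then show ?case
  proof cases
    case 1
    then show ?thesis by (blast intro: rewrite.Times_right)
  next
    case 2
    then consider "t = \<zero>" | "t = \<one>" | u where "t = u \<oplus> \<one>" | u where "t = \<ominus> u"
      unfolding numeral_trm_def by (metis pos_numeral.cases)
    then show ?thesis
      by cases (blast intro: D2_root_steps)+
  qed
qed

text \<open>A closed term that is not a numeral has a step to a closed term of smaller weight, so
  induction on the weight applies.\<close>

lemma closed_rewrites_numeral:
  "closed_trm t \<Longrightarrow> \<exists>n. numeral_trm n \<and> (rewrite D2)\<^sup>*\<^sup>* t n"
proof (induction t rule: measure_induct_rule[of weight])
  case (less t)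
  show ?case
  proof (cases "numeral_trm t")
    case False
    then obtain t' where "rewrite D2 t t'"
      using closed_numeral_or_reducible less.prems by blast
    then show ?thesis
      using less rewrite_D2_weight rewrite_D2_closed
      by (meson converse_rtranclp_into_rtranclp)
  qed blast
qed

lemma pos_numeral_eval_int: "pos_numeral s \<Longrightarrow> eval_int s > 0"
  by (induction rule: pos_numeral.induct) auto

lemma pos_numeral_eq:
  "pos_numeral s \<Longrightarrow> pos_numeral t \<Longrightarrow> eval_int s = eval_int t \<Longrightarrow> s = t"
proof (induction s arbitrary: t rule: pos_numeral.induct)
  case One
  from One(1) show ?case
  proof cases
    \<comment> \<open>Here \<open>t'\<close> would have value 0, against its positivity.\<close>
    case (Succ t')
    then show ?thesis using One(2) pos_numeral_eval_int[of t'] by simp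
  qed simp
next
  case (Succ s)
  from Succ.prems(1) show ?case
  proof cases
    case One
    then show ?thesis using Succ.prems(2) pos_numeral_eval_int[OF Succ.hyps] by simp
  next
    case (Succ t')
    then show ?thesis using Succ.prems(2) Succ.IH by simp
  qed
qed

text \<open>The sign of the value determines which of the three shapes occurs; within a shape,
  equality reduces to that of positive numerals.\<close>

lemma numeral_trm_eq:
  assumes "numeral_trm s" "numeral_trm t" "eval_int s = eval_int t"
  shows "s = t"
  using assms unfolding numeral_trm_def
  by (auto dest: pos_numeral_eq) (auto dest!: pos_numeral_eval_int)

lemma strongly_terminating_D2: "strongly_terminating D2"
  unfolding strongly_terminating_def
proof
  assume "\<exists>f :: nat \<Rightarrow> trm. \<forall>i. rewrite D2 (f i) (f (Suc i))"
  then obtain f :: "nat \<Rightarrow> trm" where "\<And>i. (f (Suc i), f i) \<in> measure weight"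
    using rewrite_D2_weight by auto
  then have "\<not> wf (measure weight)"
    unfolding wf_iff_no_infinite_down_chain by blast
  then show False by simp
qed

lemma ground_confluent_D2: "ground_confluent D2"
  unfolding ground_confluent_def
proof (intro allI impI, elim conjE)
  fix s t u
  assume closed: "closed_trm t" "closed_trm u"
    and st: "(rewrite D2)\<^sup>*\<^sup>* s t" and su: "(rewrite D2)\<^sup>*\<^sup>* s u"
  obtain m n where m: "numeral_trm m" "(rewrite D2)\<^sup>*\<^sup>* t m"
    and n: "numeral_trm n" "(rewrite D2)\<^sup>*\<^sup>* u n"
    using closed closed_rewrites_numeral by blast
  \<comment> \<open>Both values equal \<open>eval_int s\<close>.\<close>
  have "eval_int m = eval_int n"
    using st su m(2) n(2) by (metis rewrites_D2_eval_int)
  then have "m = n"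
    using m n numeral_trm_eq by blast
  then show "\<exists>v. closed_trm v \<and> (rewrite D2)\<^sup>*\<^sup>* t v \<and> (rewrite D2)\<^sup>*\<^sup>* u v"
    using m n closed rewrites_D2_closed by blast
qed

theorem theorem2p2p1: "ground_complete D2"
  unfolding ground_complete_def
  using strongly_terminating_D2 ground_confluent_D2 by blast

end
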